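(* Let $S$ be a convex subset of a real vector space such that $\operatorname{icr} S\neq\emptyset$, let $\varphi:S\to\mathbb{R}$ be a convex function, and let $C$ be a convex subset of $S$ that is symmetric with respect to a point $p\in C$ and such that $\varphi|_C$ is bounded above. Let $\mu$ be the Minkowski functional of the set $C-p$. Then $\varphi$ is locally $\mu$-Lipschitz on $\operatorname{icr} S$.
   Context: A convex set $C$ is symmetric with respect to $p\in C$ if $C-p=-(C-p)$. The relative algebraic interior of $S$ is $\operatorname{icr}S=\{x\in S:\text{ for every }y\in\operatorname{span}(S-S)\text{ there is }t>0\text{ with }x+ty\in S\}$, where $S-S=\{a-b:a,b\in S\}$. The Minkowski functional of a set $D$ is $\mu_D(x)=\inf\{t>0:x\in tD\}$, with $\inf\emptyset=+\infty$. A function $\varphi$ is $\mu$-Lipschitz on a set $D$ if there is $L>0$ with $|\varphi(x)-\varphi(y)|\le L\mu(x-y)$ for all $x,y\in D$. It is locally $\mu$-Lipschitz on $D\subset S$ (with $\mu$ the Minkowski functional of $C-p$) if for every $x\in D$ there exists $\varepsilon>0$ such that $\varepsilon(C-p)+x\subset S$ and $\varphi$ is $\mu$-Lipschitz on $\varepsilon(C-p)+x$. *)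

theory Defs
  imports "HOL-Analysis.Analysis"
begin

definition symmetric_wrt :: "'a::real_vector set \<Rightarrow> 'a \<Rightarrow> bool" where
  "symmetric_wrt C p \<longleftrightarrow>
     p \<in> C \<and> (\<lambda>x. x - p) ` C = uminus ` ((\<lambda>x. x - p) ` C)"

definition icr :: "'a::real_vector set \<Rightarrow> 'a set" where
  "icr S = {x \<in> S. \<forall>y \<in> span {a - b | a b. a \<in> S \<and> b \<in> S}. \<exists>t>0. x + t *\<^sub>R y \<in> S}"

(* Extended-real valued, so that the infimum of the empty set is infinity. *)
definition minkowski_functional :: "'a::real_vector set \<Rightarrow> 'a \<Rightarrow> ereal" where
  "minkowski_functional D x = Inf {ereal t | t. t > 0 \<and> x \<in> (\<lambda>d. t *\<^sub>R d) ` D}"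

definition mu_lipschitz_on ::
    "('a::real_vector \<Rightarrow> ereal) \<Rightarrow> 'a set \<Rightarrow> ('a \<Rightarrow> real) \<Rightarrow> bool" where
  "mu_lipschitz_on \<mu> D \<phi> \<longleftrightarrow>
     (\<exists>L::real. L > 0 \<and>
        (\<forall>x\<in>D. \<forall>y\<in>D. ereal \<bar>\<phi> x - \<phi> y\<bar> \<le> ereal L * \<mu> (x - y)))"

(* S is the domain of phi; mu is the Minkowski functional of C - p. *)
definition locally_mu_lipschitz_on ::
    "'a::real_vector set \<Rightarrow> 'a set \<Rightarrow> 'a \<Rightarrow> 'a set \<Rightarrow> ('a \<Rightarrow> real) \<Rightarrow> bool" where
  "locally_mu_lipschitz_on S C p D \<phi> \<longleftrightarrow>
     D \<subseteq> S \<and>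
     (\<forall>x\<in>D. \<exists>\<epsilon>::real. \<epsilon> > 0 \<and>
        (\<lambda>c. \<epsilon> *\<^sub>R (c - p) + x) ` C \<subseteq> S \<and>
        mu_lipschitz_on (minkowski_functional ((\<lambda>c. c - p) ` C))
          ((\<lambda>c. \<epsilon> *\<^sub>R (c - p) + x) ` C) \<phi>)"

end

theory Submission imports Defs begin

text \<open>
  Pushing \<open>x \<in> icr S\<close> slightly away from \<open>p\<close> stays in \<open>S\<close>, so \<open>x\<close> is a proper convex combination
  of \<open>p\<close> and some \<open>z \<in> S\<close>. Shrinking \<open>C\<close> towards \<open>z\<close> then gives a copy \<open>x + r D\<close> of \<open>D = C - p\<close>
  inside \<open>S\<close> on which \<open>\<phi>\<close> is bounded above, and by symmetry about \<open>x\<close> also below. On the half-size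
  copy, whenever \<open>a - b = t d\<close> with \<open>d \<in> D\<close>, prolonging the segment from \<open>b\<close> to \<open>a\<close> by \<open>(r / 2) d\<close>
  stays in \<open>x + r D\<close>, and convexity along this segment bounds \<open>\<phi> a - \<phi> b\<close> linearly in \<open>t\<close>.
\<close>

lemma symmetric_wrt_uminus_mem:
  assumes "symmetric_wrt C p" and "d \<in> (\<lambda>c. c - p) ` C"
  shows "- d \<in> (\<lambda>c. c - p) ` C"
  using assms unfolding symmetric_wrt_def by (metis imageI)

lemma le_minkowski_functional:
  assumes "\<And>t d. t > 0 \<Longrightarrow> d \<in> D \<Longrightarrow> x = t *\<^sub>R d \<Longrightarrow> c \<le> t"
  shows "ereal c \<le> minkowski_functional D x"
  unfolding minkowski_functional_def by (rule Inf_greatest) (auto intro: assms)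

lemma icr_extend:
  assumes "x \<in> icr S" and "p \<in> S"
  obtains t where "t > 0" and "x + t *\<^sub>R (x - p) \<in> S"
proof -
  have "x - p \<in> span {a - b | a b. a \<in> S \<and> b \<in> S}"
    using assms by (intro span_base) (auto simp: icr_def)
  then show ?thesis
    using assms that by (auto simp: icr_def)
qed

lemma icr_copy_bounded_above:
  fixes \<phi> :: "'a::real_vector \<Rightarrow> real"
  assumes "convex S" and "convex_on S \<phi>" and "x \<in> icr S" and "p \<in> C" and "C \<subseteq> S"
    and "bdd_above (\<phi> ` C)"
  obtains r K where "r > 0"
    and "\<And>d. d \<in> (\<lambda>c. c - p) ` C \<Longrightarrow> x + r *\<^sub>R d \<in> S \<and> \<phi> (x + r *\<^sub>R d) \<le> K"
proof -
  obtain t where t: "t > 0" and zS: "x + t *\<^sub>R (x - p) \<in> S"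
    using icr_extend[of x S p] assms by blast
  define z where "z = x + t *\<^sub>R (x - p)"
  \<comment> \<open>With this ratio \<open>(1 - r) *\<^sub>R z + r *\<^sub>R p = x\<close>, so the
    homothety with centre \<open>z\<close> and ratio \<open>r\<close> carries \<open>p\<close> to
    \<open>x\<close> and \<open>C\<close> to the copy of \<open>C - p\<close> scaled by
    \<open>r\<close> around \<open>x\<close>.\<close>
  define r where "r = t / (1 + t)"
  obtain M where M: "\<And>c. c \<in> C \<Longrightarrow> \<phi> c \<le> M"
    using assms(6) by (auto simp: bdd_above_def)
  \<comment> \<open>Each point of the copy is a convex combination of \<open>z\<close> and a point
    of \<open>C\<close>, so a common bound for \<open>\<phi>\<close> at both is enough.\<close>
  define K where "K = max M (\<phi> z)"
  have r: "0 < r" "r < 1"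
    using t by (auto simp: r_def)
  have "(1 - r) * (1 + t) = 1" "(1 - r) * t = r"
    using t by (simp_all add: r_def field_simps)
  moreover have "(1 - r) *\<^sub>R z = ((1 - r) * (1 + t)) *\<^sub>R x - ((1 - r) * t) *\<^sub>R p"
    by (simp add: z_def algebra_simps)
  ultimately have "(1 - r) *\<^sub>R z = x - r *\<^sub>R p"
    by simp
  then have eq: "x + r *\<^sub>R (c - p) = (1 - r) *\<^sub>R z + r *\<^sub>R c" for c
    by (simp add: algebra_simps)
  have "x + r *\<^sub>R (c - p) \<in> S \<and> \<phi> (x + r *\<^sub>R (c - p)) \<le> K" if "c \<in> C" for c
  proof
    have cS: "c \<in> S"
      using that assms(5) by auto
    show "x + r *\<^sub>R (c - p) \<in> S"
      unfolding eq using assms(1) zS cS r by (intro convexD) (auto simp: z_def)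
    have "\<phi> (x + r *\<^sub>R (c - p)) \<le> (1 - r) * \<phi> z + r * \<phi> c"
      unfolding eq using r zS cS assms(2) by (intro convex_onD) (auto simp: z_def)
    also have "\<dots> \<le> (1 - r) * K + r * K"
      using r M[OF that] by (intro add_mono mult_left_mono) (auto simp: K_def)
    finally show "\<phi> (x + r *\<^sub>R (c - p)) \<le> K"
      by (simp add: algebra_simps)
  qed
  then show ?thesis
    using that r(1) by blast
qed

text \<open>Since \<open>x\<close> is the midpoint of \<open>x - v\<close> and \<open>x + v\<close>,
  an upper bound at one of them forces a lower bound at the other.\<close>

lemma convex_on_symmetric_lower_bound:
  fixes \<phi> :: "'a::real_vector \<Rightarrow> real"
  assumes "convex_on S \<phi>" and "x + v \<in> S" and "x - v \<in> S" and "\<phi> (x - v) \<le> K"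
  shows "2 * \<phi> x - K \<le> \<phi> (x + v)"
proof -
  have "x = (1 - 1/2) *\<^sub>R (x - v) + (1/2) *\<^sub>R (x + v)"
    by (simp add: algebra_simps flip: scaleR_add_left)
  then have "\<phi> x \<le> (1 - 1/2) * \<phi> (x - v) + 1/2 * \<phi> (x + v)"
    using convex_onD[OF assms(1), of "1/2" "x - v" "x + v"] assms by simp
  then show ?thesis
    using assms(4) by simp
qed

lemma convex_on_prolong_diff_le:
  fixes \<phi> :: "'a::real_vector \<Rightarrow> real"
  assumes "convex_on S \<phi>" and "a - t *\<^sub>R d \<in> S" and "a + e *\<^sub>R d \<in> S" and "t > 0" and "e > 0"
    and "\<phi> (a + e *\<^sub>R d) - \<phi> (a - t *\<^sub>R d) \<le> B" and "B \<ge> 0"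
  shows "\<phi> a - \<phi> (a - t *\<^sub>R d) \<le> t / e * B"
proof -
  \<comment> \<open>The parameter of \<open>a\<close> on the segment from
    \<open>a - t *\<^sub>R d\<close> to \<open>a + e *\<^sub>R d\<close>.\<close>
  define s where "s = t / (e + t)"
  have s: "0 \<le> s" "s \<le> 1" "s \<le> t / e"
    using assms(4,5) by (auto simp: s_def intro!: divide_left_mono)
  have "s * (e + t) = t"
    using assms(4,5) by (simp add: s_def)
  moreover have "(1 - s) *\<^sub>R (a - t *\<^sub>R d) + s *\<^sub>R (a + e *\<^sub>R d) = a + (s * (e + t) - t) *\<^sub>R d"
    by (simp add: algebra_simps)
  ultimately have "\<phi> a \<le> (1 - s) * \<phi> (a - t *\<^sub>R d) + s * \<phi> (a + e *\<^sub>R d)"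
    using convex_onD[OF assms(1) s(1,2) assms(2,3)] by simp
  then have "\<phi> a - \<phi> (a - t *\<^sub>R d) \<le> s * (\<phi> (a + e *\<^sub>R d) - \<phi> (a - t *\<^sub>R d))"
    by (simp add: algebra_simps)
  also have "\<dots> \<le> s * B"
    using s assms(6) by (intro mult_left_mono)
  \<comment> \<open>Dropping \<open>t\<close> from the denominator of \<open>s\<close> makes the
    bound linear in \<open>t\<close>.\<close>
  also have "\<dots> \<le> t / e * B"
    using s assms(7) by (intro mult_right_mono)
  finally show ?thesis .
qed

lemma mu_lipschitz_on_minkowski_functionalI:
  fixes \<phi> :: "'a::real_vector \<Rightarrow> real"
  assumes "L > 0" and neg: "\<And>d. d \<in> D \<Longrightarrow> - d \<in> D"
    and step: "\<And>a b t d. a \<in> A \<Longrightarrow> b \<in> A \<Longrightarrow> t > 0 \<Longrightarrow> d \<in> D \<Longrightarrow> a - b = t *\<^sub>R d \<Longrightarrow>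
           \<phi> a - \<phi> b \<le> t * L"
  shows "mu_lipschitz_on (minkowski_functional D) A \<phi>"
  unfolding mu_lipschitz_on_def
proof (intro exI conjI ballI)
  fix a b assume ab: "a \<in> A" "b \<in> A"
  have "\<bar>\<phi> a - \<phi> b\<bar> / L \<le> t" if "t > 0" "d \<in> D" "a - b = t *\<^sub>R d" for t d
  proof -
    have "b - a = t *\<^sub>R (- d)"
      using that(3) by (metis minus_diff_eq scaleR_minus_right)
    then have "\<bar>\<phi> a - \<phi> b\<bar> \<le> t * L"
      using step[OF ab that] step[OF ab(2,1) that(1) neg[OF that(2)]] by (simp add: abs_le_iff)
    then show ?thesis
      using assms(1) by (simp add: field_simps)
  qed
  then have "ereal (\<bar>\<phi> a - \<phi> b\<bar> / L) \<le> minkowski_functional D (a - b)"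
    by (rule le_minkowski_functional)
  then have "ereal L * ereal (\<bar>\<phi> a - \<phi> b\<bar> / L) \<le> ereal L * minkowski_functional D (a - b)"
    using assms(1) by (intro ereal_mult_left_mono) auto
  then show "ereal \<bar>\<phi> a - \<phi> b\<bar> \<le> ereal L * minkowski_functional D (a - b)"
    using assms(1) by simp
qed (use assms(1) in auto)

lemma mu_lipschitz_on_half_copy:
  fixes \<phi> :: "'a::real_vector \<Rightarrow> real"
  assumes "convex_on S \<phi>" and "convex D" and "0 \<in> D" and neg: "\<And>d. d \<in> D \<Longrightarrow> - d \<in> D"
    and "e > 0"
    and bound: "\<And>d. d \<in> D \<Longrightarrow> x + (2 * e) *\<^sub>R d \<in> S \<and> \<phi> (x + (2 * e) *\<^sub>R d) \<le> K"
  shows "(\<lambda>d. e *\<^sub>R d + x) ` D \<subseteq> S"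
    and "mu_lipschitz_on (minkowski_functional D) ((\<lambda>d. e *\<^sub>R d + x) ` D) \<phi>"
proof -
  have mid: "(1/2) *\<^sub>R u + (1/2) *\<^sub>R v \<in> D" if "u \<in> D" "v \<in> D" for u v
    using assms(2) that by (intro convexD) auto
  \<comment> \<open>The sum of two steps of size \<open>e\<close> is one step of size
    \<open>2 * e\<close> along the midpoint of \<open>u\<close> and \<open>v\<close>. Taking
    \<open>v = 0\<close> gives the half-size copy itself, and \<open>v = d\<close> gives its
    prolongations.\<close>
  have sum: "e *\<^sub>R u + x + e *\<^sub>R v \<in> S \<and> \<phi> (e *\<^sub>R u + x + e *\<^sub>R v) \<le> K"
    if "u \<in> D" "v \<in> D" for u v
    using bound[OF mid[OF that]] by (simp add: algebra_simps)
  show sub: "(\<lambda>d. e *\<^sub>R d + x) ` D \<subseteq> S"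
    using sum[OF _ assms(3)] by auto
  have lower: "2 * \<phi> x - K \<le> \<phi> (e *\<^sub>R u + x)" if "u \<in> D" for u
    using convex_on_symmetric_lower_bound[OF assms(1), of x "e *\<^sub>R u" K]
      sum[OF that assms(3)] sum[OF neg[OF that] assms(3)]
    by (simp add: add.commute)
  \<comment> \<open>The gap between the upper bound \<open>K\<close> and the lower bound
    \<open>2 * \<phi> x - K\<close>.\<close>
  define B where "B = 2 * (K - \<phi> x)"
  have B: "B \<ge> 0"
    using sum[OF assms(3,3)] by (simp add: B_def)
  show "mu_lipschitz_on (minkowski_functional D) ((\<lambda>d. e *\<^sub>R d + x) ` D) \<phi>"
  proof (rule mu_lipschitz_on_minkowski_functionalI)
    \<comment> \<open>Adding 1 keeps the constant positive even when \<open>B = 0\<close>.\<close>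
    show "B / e + 1 > 0"
      using B assms(5) by (simp add: add_nonneg_pos)
    fix a b t d
    assume a: "a \<in> (\<lambda>d. e *\<^sub>R d + x) ` D" and b: "b \<in> (\<lambda>d. e *\<^sub>R d + x) ` D"
      and t: "t > 0" and d: "d \<in> D" and ab: "a - b = t *\<^sub>R d"
    have b_eq: "b = a - t *\<^sub>R d"
      using ab by (simp add: algebra_simps)
    have w: "a + e *\<^sub>R d \<in> S" "\<phi> (a + e *\<^sub>R d) \<le> K"
      using a sum[OF _ d] by auto
    have "b \<in> S" "2 * \<phi> x - K \<le> \<phi> b"
      using b sub lower by auto
    then have "\<phi> a - \<phi> b \<le> t / e * B"
      unfolding b_eq using w B t assms(1,5)
      by (intro convex_on_prolong_diff_le) (auto simp: B_def)
    also have "\<dots> \<le> t * (B / e + 1)"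
      using t by (simp add: algebra_simps)
    finally show "\<phi> a - \<phi> b \<le> t * (B / e + 1)" .
  qed (rule neg)
qed

theorem theorem2p2:
  fixes S C :: "'a::real_vector set" and p :: 'a and \<phi> :: "'a \<Rightarrow> real"
  assumes "convex S"
    and "icr S \<noteq> {}"
    and "convex_on S \<phi>"
    and "convex C"
    and "C \<subseteq> S"
    and "symmetric_wrt C p"
    and "bdd_above (\<phi> ` C)"
  shows "locally_mu_lipschitz_on S C p (icr S) \<phi>"
  unfolding locally_mu_lipschitz_on_def
proof (intro conjI ballI)
  show "icr S \<subseteq> S"
    by (auto simp: icr_def)
  fix x assume x: "x \<in> icr S"
  let ?D = "(\<lambda>c. c - p) ` C"
  have p: "p \<in> C"
    using assms(6) by (simp add: symmetric_wrt_def)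
  obtain r K where r: "r > 0"
    and bound: "\<And>d. d \<in> ?D \<Longrightarrow> x + r *\<^sub>R d \<in> S \<and> \<phi> (x + r *\<^sub>R d) \<le> K"
    using icr_copy_bounded_above[OF assms(1,3) x p assms(5,7)] by metis
  have "convex ?D"
    using assms(4) by (rule convex_translation_subtract)
  moreover have "0 \<in> ?D"
    using p by force
  \<comment> \<open>Half of \<open>r\<close> serves as the radius, so that the bounded copy has the
    size \<open>2 * e\<close> required.\<close>
  moreover have "r / 2 > 0"
    using r by simp
  ultimately have "(\<lambda>d. (r / 2) *\<^sub>R d + x) ` ?D \<subseteq> S"
    and "mu_lipschitz_on (minkowski_functional ?D) ((\<lambda>d. (r / 2) *\<^sub>R d + x) ` ?D) \<phi>"
    using mu_lipschitz_on_half_copy[OF assms(3), of ?D "r / 2" x K] bound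
      symmetric_wrt_uminus_mem[OF assms(6)] by auto
  then show "\<exists>\<epsilon>>0. (\<lambda>c. \<epsilon> *\<^sub>R (c - p) + x) ` C \<subseteq> S \<and>
      mu_lipschitz_on (minkowski_functional ?D) ((\<lambda>c. \<epsilon> *\<^sub>R (c - p) + x) ` C) \<phi>"
    using \<open>r / 2 > 0\<close> unfolding image_image by blast
qed

end
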